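(* For any rational number $q>2$, there exists a graph $G$ such that $\gamma_f(G)<\gamma_f^\infty(G)<\gamma_{\mathrm m}^\infty(G)$ and $\gamma_f^\infty(G)=q$.
   Context: All graphs are finite, simple and undirected. $N(v)$ is the open neighbourhood and $N[v]=N(v)\cup\{v\}$ the closed neighbourhood of $v$. A fractional dominating function of $G=(V,E)$ is a function $w:V\to[0,\infty)$ with $\sum_{x\in N[v]}w(x)\ge 1$ for all $v\in V$; its total weight is $\sum_{x\in V}w(x)$, and $\gamma_f(G)$ is the smallest total weight of a fractional dominating function of $G$. Fractional eternal domination. Fix $S$. The defender chooses a fractional dominating function $w_1$ of total weight at most $S$. In each round $i\ge 1$ the attacker, who may choose attacks adaptively, attacks a vertex $v_i\in V$, and the defender chooses amounts $m_{xy,i}\ge 0$ for all $x\in V$, $y\in N(x)$, with $\sum_{y\in N(x)}m_{xy,i}\le w_i(x)$, and sets $w_{i+1}(x)=w_i(x)-\sum_{y\in N(x)}m_{xy,i}+\sum_{y\in N(x)}m_{yx,i}$. It is required that $w_{i+1}$ be a fractional dominating function and $w_{i+1}(v_i)\ge 1$. If the defender can respond in this way to every infinite sequence of attacks, $G$ can be eternally $S$-fractionally dominated. $\gamma_f^\infty(G)$ is the infimum of all $S$ for which $G$ can be eternally $S$-fractionally dominated. m-eternal domination. The defender chooses $D_1\subseteq V$ (guard positions). In each round $i\ge1$ the attacker attacks a vertex $v_i\notin D_i$, and the defender replaces $D_i$ by a set $D_{i+1}$ with $v_i\in D_{i+1}$, by moving any number of guards, each to an adjacent vertex or staying put (i.e.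 there is a bijection $\varphi:D_i\to D_{i+1}$ with $\varphi(u)\in N[u]$). $\gamma_{\mathrm m}^\infty(G)$ is the minimum $|D_1|$ for which the defender can respond to every infinite sequence of attacks. *)

theory Defs
  imports "HOL-Analysis.Analysis" "Graph_Theory.Pair_Digraph"
begin

text \<open>
  A finite simple undirected graph is a \<open>pair_graph\<close>: a finite, loop-free digraph without
  parallel arcs whose arc relation is symmetric. An edge between \<open>x\<close> and \<open>y\<close> is represented
  by the two arcs \<open>(x, y)\<close> and \<open>(y, x)\<close>.
\<close>

definition nbhd :: "'a pair_pre_digraph \<Rightarrow> 'a \<Rightarrow> 'a set" where
  "nbhd G v = {u. (v, u) \<in> parcs G}"

definition closed_nbhd :: "'a pair_pre_digraph \<Rightarrow> 'a \<Rightarrow> 'a set" where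
  "closed_nbhd G v = insert v (nbhd G v)"


section \<open>Fractional domination\<close>

text \<open>
  Only the values of a weight function at vertices matter, here and in all that follows.
\<close>

definition frac_dominating :: "'a pair_pre_digraph \<Rightarrow> ('a \<Rightarrow> real) \<Rightarrow> bool" where
  "frac_dominating G w \<longleftrightarrow>
     (\<forall>x\<in>pverts G. 0 \<le> w x) \<and> (\<forall>v\<in>pverts G. 1 \<le> (\<Sum>x\<in>closed_nbhd G v. w x))"

definition total_weight :: "'a pair_pre_digraph \<Rightarrow> ('a \<Rightarrow> real) \<Rightarrow> real" where
  "total_weight G w = (\<Sum>x\<in>pverts G. w x)"

text \<open>
  The infimum is a minimum, see \<open>frac_dom_num_attained\<close> below.
\<close>

definition frac_dom_num :: "'a pair_pre_digraph \<Rightarrow> real" where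
  "frac_dom_num G = Inf {total_weight G w | w. frac_dominating G w}"

lemma frac_dom_num_attained:
  fixes G :: "'a pair_pre_digraph"
  assumes "pair_graph G"
  shows "\<exists>w. frac_dominating G w \<and> total_weight G w = frac_dom_num G"
proof -
  interpret pair_graph G by fact
  define K :: "('a \<Rightarrow> real) set" where
    "K = (\<Pi>\<^sub>E x\<in>UNIV. if x \<in> pverts G then {0..1} else {0})"
  define C where
    "C = K \<inter> (\<Inter>v\<in>pverts G. {w. 1 \<le> (\<Sum>x\<in>closed_nbhd G v. w x)})"
  have nb_fin: "finite (closed_nbhd G v)" and nb_sub: "closed_nbhd G v \<subseteq> pverts G"
    if "v \<in> pverts G" for v
  proof -
    show "closed_nbhd G v \<subseteq> pverts G"
      using that by (auto simp: closed_nbhd_def nbhd_def dest: in_arcsD2)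
    then show "finite (closed_nbhd G v)"
      using pair_finite_verts finite_subset by blast
  qed
  have cont: "continuous_on UNIV (\<lambda>w::'a \<Rightarrow> real. \<Sum>x\<in>A. w x)" for A
    by (intro continuous_on_sum continuous_on_product_coordinates)
  have "compactin (product_topology (\<lambda>_. euclidean) UNIV) K"
    unfolding K_def by (rule compactin_PiE[THEN iffD2]) auto
  then have "compact K"
    by (simp add: euclidean_product_topology)
  moreover have "closed (\<Inter>v\<in>pverts G. {w::'a \<Rightarrow> real. 1 \<le> (\<Sum>x\<in>closed_nbhd G v. w x)})"
    by (intro closed_INT ballI closed_Collect_le cont continuous_on_const)
  ultimately have "compact C"
    unfolding C_def by (rule compact_Int_closed)
  have C_dom: "frac_dominating G w" if "w \<in> C" for w
    using that by (force simp: C_def K_def frac_dominating_def PiE_iff split: if_splits)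
  have trunc: "(\<lambda>x. if x \<in> pverts G then min (w x) 1 else 0) \<in> C" (is "?t \<in> C")
    if w: "frac_dominating G w" for w
  proof -
    have "1 \<le> (\<Sum>x\<in>closed_nbhd G v. ?t x)" if v: "v \<in> pverts G" for v
    proof (cases "\<exists>x\<in>closed_nbhd G v. 1 \<le> w x")
      case True
      then obtain x where x: "x \<in> closed_nbhd G v" "1 \<le> w x" by blast
      have "?t x \<le> (\<Sum>x\<in>closed_nbhd G v. ?t x)"
        by (rule member_le_sum) (use x w nb_fin[OF v] in \<open>auto simp: frac_dominating_def\<close>)
      moreover have "?t x = 1" using x nb_sub[OF v] by auto
      ultimately show ?thesis by simp
    next
      case False
      then have "(\<Sum>x\<in>closed_nbhd G v. ?t x) = (\<Sum>x\<in>closed_nbhd G v. w x)"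
        using nb_sub[OF v] by (intro sum.cong) (auto simp: min_def)
      then show ?thesis using w v by (simp add: frac_dominating_def)
    qed
    then show ?thesis
      using w by (auto simp: C_def K_def PiE_iff frac_dominating_def)
  qed
  have trunc_le: "total_weight G (\<lambda>x. if x \<in> pverts G then min (w x) 1 else 0) \<le> total_weight G w"
    for w
    unfolding total_weight_def by (rule sum_mono) auto
  have "frac_dominating G (\<lambda>_. 1)"
  proof -
    have "1 \<le> card (closed_nbhd G v)" if "v \<in> pverts G" for v
      using nb_fin[OF that] by (auto simp: closed_nbhd_def card_gt_0_iff Suc_le_eq)
    then show ?thesis by (auto simp: frac_dominating_def)
  qed
  then have "C \<noteq> {}" using trunc by blast
  moreover have "continuous_on C (total_weight G)"
    unfolding total_weight_def[abs_def] by (rule continuous_on_subset[OF cont]) simp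
  ultimately obtain w where w: "w \<in> C" "\<And>u. u \<in> C \<Longrightarrow> total_weight G w \<le> total_weight G u"
    using continuous_attains_inf[OF \<open>compact C\<close>] by blast
  have "frac_dom_num G = total_weight G w"
    unfolding frac_dom_num_def
  proof (rule cInf_eq_minimum)
    show "total_weight G w \<in> {total_weight G w | w. frac_dominating G w}"
      using C_dom w(1) by blast
    show "total_weight G w \<le> s" if "s \<in> {total_weight G w | w. frac_dominating G w}" for s
      using that w(2) trunc trunc_le by (blast intro: order_trans)
  qed
  then show ?thesis using C_dom w(1) by metis
qed


section \<open>Fractional eternal domination\<close>

text \<open>
  \<open>m x y\<close> is the amount of weight moved from \<open>x\<close> to its neighbour \<open>y\<close>.
\<close>

definition legal_move :: "'a pair_pre_digraph \<Rightarrow> ('a \<Rightarrow> real) \<Rightarrow> ('a \<Rightarrow> 'a \<Rightarrow> real) \<Rightarrow> bool" where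
  "legal_move G w m \<longleftrightarrow>
     (\<forall>x\<in>pverts G. (\<forall>y\<in>nbhd G x. 0 \<le> m x y) \<and> (\<Sum>y\<in>nbhd G x. m x y) \<le> w x)"

definition apply_move ::
    "'a pair_pre_digraph \<Rightarrow> ('a \<Rightarrow> real) \<Rightarrow> ('a \<Rightarrow> 'a \<Rightarrow> real) \<Rightarrow> 'a \<Rightarrow> real" where
  "apply_move G w m x = w x - (\<Sum>y\<in>nbhd G x. m x y) + (\<Sum>y\<in>nbhd G x. m y x)"

text \<open>
  Rounds are numbered from 0 here, so the attack of the first round is \<open>a 0\<close>. A strategy
  \<open>\<sigma>\<close> of the defender maps the list of attacks made so far, including the current one, to a
  move; it cannot look ahead. As the strategy and the past attacks determine the
  position, an adaptive attacker is covered by quantifying over all attack sequences \<open>a\<close>.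
\<close>

primrec frac_play ::
    "'a pair_pre_digraph \<Rightarrow> ('a \<Rightarrow> real) \<Rightarrow> ('a list \<Rightarrow> 'a \<Rightarrow> 'a \<Rightarrow> real) \<Rightarrow> (nat \<Rightarrow> 'a)
      \<Rightarrow> nat \<Rightarrow> 'a \<Rightarrow> real" where
  "frac_play G w \<sigma> a 0 = w"
| "frac_play G w \<sigma> a (Suc i) = apply_move G (frac_play G w \<sigma> a i) (\<sigma> (map a [0..<Suc i]))"

definition eternally_frac_dominated :: "'a pair_pre_digraph \<Rightarrow> real \<Rightarrow> bool" where
  "eternally_frac_dominated G S \<longleftrightarrow>
     (\<exists>w \<sigma>. frac_dominating G w \<and> total_weight G w \<le> S \<and>
       (\<forall>a. (\<forall>i. a i \<in> pverts G) \<longrightarrow>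
         (\<forall>i. legal_move G (frac_play G w \<sigma> a i) (\<sigma> (map a [0..<Suc i])) \<and>
              frac_dominating G (frac_play G w \<sigma> a (Suc i)) \<and>
              1 \<le> frac_play G w \<sigma> a (Suc i) (a i))))"

definition frac_eternal_dom_num :: "'a pair_pre_digraph \<Rightarrow> real" where
  "frac_eternal_dom_num G = Inf {S. eternally_frac_dominated G S}"


section \<open>m-eternal domination\<close>

text \<open>
  Here a strategy \<open>\<rho>\<close> maps the list of attacks made so far to the map that moves the guards.
\<close>

primrec guard_play ::
    "'a set \<Rightarrow> ('a list \<Rightarrow> 'a \<Rightarrow> 'a) \<Rightarrow> (nat \<Rightarrow> 'a) \<Rightarrow> nat \<Rightarrow> 'a set" where
  "guard_play D \<rho> a 0 = D"
| "guard_play D \<rho> a (Suc i) = \<rho> (map a [0..<Suc i]) ` guard_play D \<rho> a i"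

text \<open>
  The response in round \<open>i\<close> has to be valid provided that the attacks up to that round were
  legal, i.e.\ on unguarded vertices. In particular, the defender wins with a guard on every
  vertex, as there is no legal attack.
\<close>

definition m_eternally_dominated :: "'a pair_pre_digraph \<Rightarrow> nat \<Rightarrow> bool" where
  "m_eternally_dominated G k \<longleftrightarrow>
     (\<exists>D \<rho>. D \<subseteq> pverts G \<and> card D = k \<and>
       (\<forall>a i. (\<forall>j\<le>i. a j \<in> pverts G - guard_play D \<rho> a j) \<longrightarrow>
         inj_on (\<rho> (map a [0..<Suc i])) (guard_play D \<rho> a i) \<and>
         (\<forall>u\<in>guard_play D \<rho> a i. \<rho> (map a [0..<Suc i]) u \<in> closed_nbhd G u) \<and>
         a i \<in> guard_play D \<rho> a (Suc i)))"

definition m_eternal_dom_num :: "'a pair_pre_digraph \<Rightarrow> nat" where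
  "m_eternal_dom_num G = (LEAST k. m_eternally_dominated G k)"

end

theory Submission
  imports Defs
begin

text \<open>
  Write \<open>q = 1 + n / r\<close> with \<open>n > r \<ge> 2\<close>. The graph consists of a clique \<open>A\<close> of size \<open>n\<close> and of
  independent outer vertices: one vertex with neighbourhood \<open>e\<close> for every \<open>r\<close>-subset \<open>e\<close> of \<open>A\<close>,
  and a further outer vertex \<open>b\<^sub>0\<close>, also with \<open>r\<close> neighbours in \<open>A\<close>. To dominate the outer vertices
  other than \<open>b\<^sub>0\<close>, one has to hit all \<open>r\<close>-subsets of \<open>A\<close>, since weight on an outer vertex is of no
  more use for this than the same weight on one of its neighbours. Fractionally this costs
  \<open>n / r\<close>, with weight \<open>1 / r\<close> everywhere on \<open>A\<close>; integrally it costs \<open>n - r + 1\<close>, which is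
  larger than \<open>n / r\<close> because \<open>(r - 1) (n - r) > 0\<close>.

  So \<open>\<gamma>\<^sub>f \<le> n / r\<close>. After an attack on \<open>b\<^sub>0\<close> there is weight \<open>1\<close>, respectively a guard, on \<open>b\<^sub>0\<close>,
  and this does not help to dominate the other outer vertices. Hence the fractional eternal
  number is at least \<open>1 + n / r\<close> and the m-eternal number at least \<open>1 + (n - r + 1)\<close>.

  Conversely, total weight \<open>1 + n / r\<close> suffices for the fractional defender: the weight is
  \<open>1 / r\<close> on all of \<open>A\<close>, plus one extra unit on the last attacked vertex. To carry the extra unit
  from \<open>s\<close> to \<open>t\<close>, spread it evenly over the \<open>r\<close> neighbours of \<open>s\<close> if \<open>s\<close> is an outer vertex, let
  it be collected evenly from the \<open>r\<close> neighbours of \<open>t\<close> if \<open>t\<close> is an outer vertex, and correct the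
  difference of these two distributions on \<open>A\<close> along edges of the clique. All of this happens in
  a single round, so what a vertex of \<open>A\<close> receives cannot be passed on; the basic weight \<open>1 / r\<close>
  stored there is exactly enough to do this in advance.
\<close>


section \<open>Eternal domination in general graphs\<close>

lemma nbhd_commute:
  assumes "pair_graph G"
  shows "y \<in> nbhd G x \<longleftrightarrow> x \<in> nbhd G y"
proof -
  interpret pair_graph G by fact
  show ?thesis
    using pair_sym_arcs unfolding nbhd_def symmetric_def by (auto elim: symE)
qed

lemma nbhd_subset:
  assumes "pair_graph G"
  shows "nbhd G x \<subseteq> pverts G"
proof -
  interpret pair_graph G by fact
  show ?thesis by (auto simp: nbhd_def dest: in_arcsD2)
qed

lemma total_weight_apply_move:
  assumes "pair_graph G"
  shows "total_weight G (apply_move G w m) = total_weight G w"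
proof -
  interpret pair_graph G by fact
  have fin: "finite (pverts G)" by (rule pair_finite_verts)
  have nb: "{y \<in> pverts G. y \<in> nbhd G x} = nbhd G x" for x
    using nbhd_subset[OF assms] by blast
  have nb': "{x \<in> pverts G. y \<in> nbhd G x} = nbhd G y" for y
    using nbhd_subset[OF assms] nbhd_commute[OF assms] by blast
  have "(\<Sum>x\<in>pverts G. \<Sum>y\<in>nbhd G x. m x y)
      = (\<Sum>x\<in>pverts G. \<Sum>y\<in>{y \<in> pverts G. y \<in> nbhd G x}. m x y)"
    by (simp only: nb)
  also have "\<dots> = (\<Sum>y\<in>pverts G. \<Sum>x\<in>{x \<in> pverts G. y \<in> nbhd G x}. m x y)"
    by (rule sum.swap_restrict[OF fin fin])
  also have "\<dots> = (\<Sum>y\<in>pverts G. \<Sum>x\<in>nbhd G y. m x y)"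
    by (simp only: nb')
  finally show ?thesis
    by (simp add: total_weight_def apply_move_def sum.distrib sum_subtractf)
qed

text \<open>Attacking \<open>v\<close> in the first round forces such a position, and moves preserve the total weight.\<close>

lemma eternally_frac_dominatedD:
  assumes "pair_graph G" and "eternally_frac_dominated G S" and "v \<in> pverts G"
  shows "\<exists>w. frac_dominating G w \<and> 1 \<le> w v \<and> total_weight G w \<le> S"
proof -
  from assms(2) obtain w \<sigma> where w: "total_weight G w \<le> S"
    and play: "\<And>a i. (\<forall>i. a i \<in> pverts G) \<Longrightarrow>
        frac_dominating G (frac_play G w \<sigma> a (Suc i)) \<and> 1 \<le> frac_play G w \<sigma> a (Suc i) (a i)"
    unfolding eternally_frac_dominated_def by blast
  from play[of "\<lambda>_. v" 0] assms(3) total_weight_apply_move[OF assms(1), of w] w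
  show ?thesis by auto
qed

text \<open>
  A defender who keeps one position for each possible last attack, and can move between any two
  of these positions, has a winning strategy. It is given as a function of the attack history,
  of which it only uses the last two entries.
\<close>

lemma eternally_frac_dominatedI:
  fixes G :: "'a pair_pre_digraph" and P :: "'a \<Rightarrow> 'a \<Rightarrow> real"
  assumes start: "start \<in> pverts G"
    and weight: "total_weight G (P start) \<le> S"
    and dom: "\<And>s. s \<in> pverts G \<Longrightarrow> frac_dominating G (P s)"
    and one: "\<And>s. s \<in> pverts G \<Longrightarrow> 1 \<le> P s s"
    and legal: "\<And>s t. s \<in> pverts G \<Longrightarrow> t \<in> pverts G \<Longrightarrow> legal_move G (P s) (mv s t)"
    and move: "\<And>s t. s \<in> pverts G \<Longrightarrow> t \<in> pverts G \<Longrightarrow> apply_move G (P s) (mv s t) = P t"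
  shows "eternally_frac_dominated G S"
proof -
  define \<sigma> where "\<sigma> xs = mv (last (start # butlast xs)) (last xs)" for xs
  define cur where "cur a i = (case i of 0 \<Rightarrow> start | Suc j \<Rightarrow> a j)" for a :: "nat \<Rightarrow> 'a" and i
  have \<sigma>: "\<sigma> (map a [0..<Suc i]) = mv (cur a i) (a i)" for a i
    by (cases i) (auto simp: \<sigma>_def cur_def butlast_append)
  have cur_vert: "cur a i \<in> pverts G" if "\<forall>i. a i \<in> pverts G" for a i
    using that start by (cases i) (auto simp: cur_def)
  have play: "frac_play G (P start) \<sigma> a i = P (cur a i)" if a: "\<forall>i. a i \<in> pverts G" for a i
  proof (induction i)
    case 0
    show ?case by (simp add: cur_def)
  next
    case (Suc i)
    have "frac_play G (P start) \<sigma> a (Suc i) = apply_move G (P (cur a i)) (mv (cur a i) (a i))"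
      using Suc \<sigma> by simp
    also have "\<dots> = P (cur a (Suc i))"
      using move[OF cur_vert[OF a]] a by (simp add: cur_def)
    finally show ?case .
  qed
  show ?thesis
    unfolding eternally_frac_dominated_def
  proof (intro exI conjI allI impI)
    fix a :: "nat \<Rightarrow> 'a" and i assume a: "\<forall>i. a i \<in> pverts G"
    have nxt: "frac_play G (P start) \<sigma> a (Suc i) = P (a i)"
      using play[OF a, of "Suc i"] by (simp add: cur_def)
    show "legal_move G (frac_play G (P start) \<sigma> a i) (\<sigma> (map a [0..<Suc i]))"
      using legal[OF cur_vert[OF a]] a unfolding play[OF a] \<sigma> by blast
    show "frac_dominating G (frac_play G (P start) \<sigma> a (Suc i))"
      unfolding nxt using dom a by blast
    show "1 \<le> frac_play G (P start) \<sigma> a (Suc i) (a i)"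
      unfolding nxt using one a by blast
  qed (use weight dom start in auto)
qed

text \<open>
  Either the initial position occupies \<open>v\<close>, or an attack on \<open>v\<close> leads to a position that does.
  This position is dominating, as the defender loses at once to an attack on an undominated vertex.
\<close>

lemma m_eternally_dominatedD:
  assumes "pair_graph G" and "m_eternally_dominated G k" and v: "v \<in> pverts G"
  shows "\<exists>D \<subseteq> pverts G. card D = k \<and> v \<in> D \<and> pverts G \<subseteq> (\<Union>u\<in>D. closed_nbhd G u)"
proof -
  from assms(2) obtain D \<rho> where D: "D \<subseteq> pverts G" "card D = k"
    and play: "\<And>a i. (\<forall>j\<le>i. a j \<in> pverts G - guard_play D \<rho> a j) \<Longrightarrow>
         inj_on (\<rho> (map a [0..<Suc i])) (guard_play D \<rho> a i) \<and>
         (\<forall>u\<in>guard_play D \<rho> a i. \<rho> (map a [0..<Suc i]) u \<in> closed_nbhd G u) \<and>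
         a i \<in> guard_play D \<rho> a (Suc i)"
    unfolding m_eternally_dominated_def by blast
  have closed_sub: "closed_nbhd G u \<subseteq> pverts G" if "u \<in> pverts G" for u
    using that nbhd_subset[OF assms(1)] by (auto simp: closed_nbhd_def)
  show ?thesis
  proof (cases "v \<in> D")
    case True
    have "u \<in> (\<Union>u\<in>D. closed_nbhd G u)" if "u \<in> pverts G" for u
    proof (cases "u \<in> D")
      case False
      then have "u \<in> \<rho> [u] ` D" and "\<forall>x\<in>D. \<rho> [u] x \<in> closed_nbhd G x"
        using play[of 0 "\<lambda>_. u"] that by auto
      then obtain x where "x \<in> D" "u = \<rho> [u] x" by blast
      then show ?thesis using \<open>\<forall>x\<in>D. \<rho> [u] x \<in> closed_nbhd G x\<close> by (metis UN_I)
    qed (auto simp: closed_nbhd_def)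
    with True D show ?thesis by blast
  next
    case False
    define D' where "D' = \<rho> [v] ` D"
    have 1: "inj_on (\<rho> [v]) D" "\<forall>u\<in>D. \<rho> [v] u \<in> closed_nbhd G u" "v \<in> D'"
      using play[of 0 "\<lambda>_. v"] v False by (auto simp: D'_def)
    have "card D' = k" using 1 D by (simp add: D'_def card_image)
    moreover have "D' \<subseteq> pverts G" using 1 D closed_sub by (fastforce simp: D'_def)
    moreover have "u \<in> (\<Union>u\<in>D'. closed_nbhd G u)" if "u \<in> pverts G" for u
    proof (cases "u \<in> D'")
      case u: False
      define a where "a i = (case i of 0 \<Rightarrow> v | Suc _ \<Rightarrow> u)" for i :: nat
      have gp: "guard_play D \<rho> a (Suc 0) = D'" by (simp add: a_def D'_def)
      have "\<forall>j\<le>Suc 0. a j \<in> pverts G - guard_play D \<rho> a j"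
      proof (intro allI impI)
        fix j :: nat assume "j \<le> Suc 0"
        then consider "j = 0" | "j = Suc 0" by linarith
        then show "a j \<in> pverts G - guard_play D \<rho> a j"
          using gp u that v False by cases (simp_all add: a_def)
      qed
      from play[OF this]
      have cl: "\<forall>x\<in>D'. \<rho> (map a [0..<Suc (Suc 0)]) x \<in> closed_nbhd G x"
        and "a (Suc 0) \<in> \<rho> (map a [0..<Suc (Suc 0)]) ` D'"
        unfolding guard_play.simps(2)[of D \<rho> a "Suc 0"] gp by blast+
      then obtain x where "x \<in> D'" "a (Suc 0) = \<rho> (map a [0..<Suc (Suc 0)]) x" by blast
      moreover have "a (Suc 0) = u" by (simp add: a_def)
      ultimately show ?thesis using cl by (metis UN_I)
    qed (auto simp: closed_nbhd_def)
    ultimately show ?thesis using 1(3) by blast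
  qed
qed

text \<open>Some number of guards suffices: with a guard on every vertex there is no legal attack.\<close>

lemma m_eternally_dominated_m_eternal_dom_num:
  "m_eternally_dominated G (m_eternal_dom_num G)"
proof -
  have "m_eternally_dominated G (card (pverts G))"
    unfolding m_eternally_dominated_def
    by (rule exI[of _ "pverts G"]) (auto dest!: spec[of _ 0])
  then show ?thesis
    unfolding m_eternal_dom_num_def by (rule LeastI)
qed


section \<open>Transport and averaging\<close>

text \<open>
  The excess of \<open>p\<close> over \<open>q\<close> and the excess of \<open>q\<close> over \<open>p\<close> have the same total \<open>T\<close>, so their product
  divided by \<open>T\<close> ships one to the other. If \<open>T = 0\<close> then \<open>p = q\<close>, and division by zero gives the
  right value \<open>0\<close>. As nothing is both in excess and missing at the same place, nothing is shipped
  from a place to itself.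
\<close>

lemma excess_transport:
  fixes p q :: "'a \<Rightarrow> real"
  assumes "finite A" and "sum p A = sum q A"
  defines "T \<equiv> (\<Sum>a\<in>A. max 0 (p a - q a))"
  defines "c \<equiv> \<lambda>x y. max 0 (p x - q x) * max 0 (q y - p y) / T"
  shows "0 \<le> c x y"
    and "x \<in> A \<Longrightarrow> (\<Sum>y\<in>A - {x}. c x y) = max 0 (p x - q x)"
    and "y \<in> A \<Longrightarrow> (\<Sum>x\<in>A - {y}. c x y) = max 0 (q y - p y)"
proof -
  have "T - (\<Sum>a\<in>A. max 0 (q a - p a)) = (\<Sum>a\<in>A. p a - q a)"
    unfolding T_def sum_subtractf[symmetric] by (intro sum.cong) (auto simp: max_def)
  then have T': "(\<Sum>a\<in>A. max 0 (q a - p a)) = T"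
    using assms(2) by (simp add: sum_subtractf)
  have Tnn: "0 \<le> T" unfolding T_def by (intro sum_nonneg) auto
  then show "0 \<le> c x y" by (simp add: c_def)
  have diag: "c x x = 0" for x by (auto simp: c_def max_def)
  have T0: "max 0 (p x - q x) = 0" "max 0 (q x - p x) = 0" if "x \<in> A" "T = 0" for x
    using that assms(1) T' sum_nonneg_eq_0_iff[of A "\<lambda>a. max 0 (p a - q a)"]
      sum_nonneg_eq_0_iff[of A "\<lambda>a. max 0 (q a - p a)"] by (auto simp: T_def)
  show "(\<Sum>y\<in>A - {x}. c x y) = max 0 (p x - q x)" if x: "x \<in> A"
  proof -
    have "(\<Sum>y\<in>A - {x}. c x y) = (\<Sum>y\<in>A. c x y)"
      using sum.remove[OF assms(1) x, of "c x"] diag by simp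
    also have "\<dots> = max 0 (p x - q x) * T / T"
      unfolding c_def sum_divide_distrib[symmetric] sum_distrib_left[symmetric] T' ..
    also have "\<dots> = max 0 (p x - q x)" using T0[OF x] by (cases "T = 0") auto
    finally show ?thesis .
  qed
  show "(\<Sum>x\<in>A - {y}. c x y) = max 0 (q y - p y)" if y: "y \<in> A"
  proof -
    have "(\<Sum>x\<in>A - {y}. c x y) = (\<Sum>x\<in>A. c x y)"
      using sum.remove[OF assms(1) y, of "\<lambda>x. c x y"] diag by simp
    also have "\<dots> = T * max 0 (q y - p y) / T"
      unfolding c_def sum_divide_distrib[symmetric] sum_distrib_right[symmetric] T_def ..
    also have "\<dots> = max 0 (q y - p y)" using T0[OF y] by (cases "T = 0") auto
    finally show ?thesis .
  qed
qed

lemma card_subsets_containing: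
  assumes "finite A" "a \<in> A"
  shows "card {e. e \<subseteq> A \<and> card e = Suc k \<and> a \<in> e} = (card A - 1) choose k"
proof -
  let ?X = "{e. e \<subseteq> A \<and> card e = Suc k}" and ?Y = "{e. e \<subseteq> A - {a} \<and> card e = Suc k}"
  have "{e. e \<subseteq> A \<and> card e = Suc k \<and> a \<in> e} = ?X - ?Y" by auto
  moreover have "finite ?Y" "?Y \<subseteq> ?X"
    using assms(1) by (auto intro: finite_subset[of _ "Pow (A - {a})"])
  ultimately have "card {e. e \<subseteq> A \<and> card e = Suc k \<and> a \<in> e}
      = (card A choose Suc k) - ((card A - 1) choose Suc k)"
    using assms by (simp add: card_Diff_subset n_subsets)
  moreover obtain n where "card A = Suc n"
    using assms by (metis card_Suc_Diff1)
  ultimately show ?thesis by simp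
qed


section \<open>The clique with outer vertices\<close>

definition clique_with_outer :: "'a set \<Rightarrow> 'a set \<Rightarrow> ('a \<Rightarrow> 'a set) \<Rightarrow> 'a pair_pre_digraph" where
  "clique_with_outer A B f = \<lparr>pverts = A \<union> B,
     parcs = {(x, y). x \<in> A \<and> y \<in> A \<and> x \<noteq> y \<or> x \<in> B \<and> y \<in> f x \<or> y \<in> B \<and> x \<in> f y}\<rparr>"

locale clique_with_subsets =
  fixes A B :: "'a set" and f :: "'a \<Rightarrow> 'a set" and r :: nat and b0 :: 'a
  assumes finA: "finite A" and finB: "finite B" and disj: "A \<inter> B = {}"
    and nb_sub: "b \<in> B \<Longrightarrow> f b \<subseteq> A" and nb_card: "b \<in> B \<Longrightarrow> card (f b) = r"
    and b0: "b0 \<in> B"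
    and bij: "bij_betw f (B - {b0}) {e. e \<subseteq> A \<and> card e = r}"
    and r_pos: "0 < r" and r_le: "r \<le> card A"
begin

abbreviation G where "G \<equiv> clique_with_outer A B f"

lemma verts: "pverts G = A \<union> B"
  by (simp add: clique_with_outer_def)

lemma nbhd_clique: "x \<in> A \<Longrightarrow> nbhd G x = (A - {x}) \<union> {b \<in> B. x \<in> f b}"
  using disj by (auto simp: nbhd_def clique_with_outer_def)

lemma nbhd_outer: "x \<in> B \<Longrightarrow> nbhd G x = f x"
  using disj nb_sub by (auto simp: nbhd_def clique_with_outer_def)

lemma nbhd_outside: "x \<notin> A \<union> B \<Longrightarrow> nbhd G x = {}"
  using nb_sub by (auto simp: nbhd_def clique_with_outer_def)

lemma pair_graph_G: "pair_graph G"
proof unfold_locales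
  show "finite (pverts G)" using finA finB by (simp add: verts)
  have "parcs G \<subseteq> (A \<union> B) \<times> (A \<union> B)"
    using nb_sub by (auto simp: clique_with_outer_def)
  then show "finite (parcs G)" using finA finB by (meson finite_SigmaI finite_UnI finite_subset)
  show "symmetric (with_proj G)"
    by (auto simp: symmetric_def clique_with_outer_def intro!: symI)
qed (use disj in \<open>auto simp: clique_with_outer_def dest: subsetD[OF nb_sub]\<close>)

lemma fin_nb: "b \<in> B \<Longrightarrow> finite (f b)"
  using nb_sub finA finite_subset by blast

lemma total_weight_split: "total_weight G w = sum w A + sum w B"
  using finA finB disj by (simp add: total_weight_def verts sum.union_disjoint)

lemma frac_dominating_if_ge:
  assumes "\<And>x. x \<in> A \<Longrightarrow> 1 / real r \<le> w x" and "\<And>x. x \<in> B \<Longrightarrow> 0 \<le> w x"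
  shows "frac_dominating G w"
proof -
  have nn: "0 \<le> w x" if "x \<in> A \<union> B" for x
    using that assms by (meson UnE divide_nonneg_nonneg of_nat_0_le_iff order_trans zero_le_one)
  have "1 \<le> (\<Sum>x\<in>closed_nbhd G v. w x)" if v: "v \<in> A \<union> B" for v
  proof -
    obtain e where e: "e \<subseteq> closed_nbhd G v" "e \<subseteq> A" "card e \<ge> r"
    proof (cases "v \<in> A")
      case True
      then show ?thesis using that[of A] nbhd_clique[OF True] r_le by (auto simp: closed_nbhd_def)
    next
      case False
      then have "v \<in> B" using v by blast
      then show ?thesis using that[of "f v"] nb_sub nb_card
        by (auto simp: closed_nbhd_def nbhd_outer)
    qed
    have sub: "closed_nbhd G v \<subseteq> A \<union> B"
      using nbhd_subset[OF pair_graph_G] v by (auto simp: closed_nbhd_def verts)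
    have "1 \<le> real (card e) * (1 / real r)" using e(3) r_pos by (simp add: field_simps)
    also have "\<dots> \<le> sum w e"
      using sum_mono[of e "\<lambda>_. 1 / real r" w] assms(1) e(2) by auto
    also have "\<dots> \<le> sum w (closed_nbhd G v)"
      using e(1) sub nn finA finB by (intro sum_mono2) (auto intro: finite_subset)
    finally show ?thesis .
  qed
  then show ?thesis using nn by (auto simp: frac_dominating_def verts)
qed

lemma frac_dom_num_le: "frac_dom_num G \<le> real (card A) / real r"
proof -
  let ?w = "\<lambda>x. if x \<in> A then 1 / real r else 0"
  have "total_weight G ?w = real (card A) / real r"
  proof -
    have "sum ?w B = 0" using disj by (intro sum.neutral) auto
    then show ?thesis by (simp add: total_weight_split)
  qed
  moreover have "frac_dominating G ?w" by (rule frac_dominating_if_ge) auto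
  ultimately have "real (card A) / real r \<in> {total_weight G w | w. frac_dominating G w}"
    by (intro CollectI exI[of _ ?w]) simp
  moreover have "bdd_below {total_weight G w | w. frac_dominating G w}"
    by (rule bdd_belowI[of _ 0])
      (auto simp: total_weight_def frac_dominating_def intro!: sum_nonneg)
  ultimately show ?thesis
    unfolding frac_dom_num_def by (rule cInf_lower)
qed

text \<open>
  Add up the domination constraints of all outer vertices other than \<open>b0\<close>. Every vertex of \<open>A\<close>
  occurs in \<open>d\<close> of them, every outer vertex in at most one, and \<open>d \<ge> 1\<close>. Hence the
  weight outside \<open>b0\<close> is at least the number of constraints over \<open>d\<close>, which is \<open>card A / r\<close>.
\<close>

lemma total_weight_ge:
  assumes dom: "frac_dominating G w" and one: "1 \<le> w b0"
  shows "1 + real (card A) / real r \<le> total_weight G w"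
proof -
  define B' where "B' = B - {b0}"
  define d where "d = ((card A - 1) choose (r - 1))"
  have nn: "0 \<le> w x" if "x \<in> A \<union> B" for x
    using dom that by (auto simp: frac_dominating_def verts)
  have constr: "1 \<le> w b + sum w (f b)" if "b \<in> B" for b
  proof -
    have "b \<notin> f b" using that nb_sub disj by blast
    moreover have "1 \<le> sum w (insert b (f b))"
      using dom that by (simp add: frac_dominating_def verts closed_nbhd_def nbhd_outer[symmetric])
    ultimately show ?thesis using fin_nb[OF that] by simp
  qed
  have deg: "card {b \<in> B'. a \<in> f b} = d" if a: "a \<in> A" for a
  proof -
    have "bij_betw f {b \<in> B'. a \<in> f b} {e. e \<subseteq> A \<and> card e = Suc (r - 1) \<and> a \<in> e}"
      unfolding bij_betw_def
    proof
      show "inj_on f {b \<in> B'. a \<in> f b}"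
        using bij by (auto simp: bij_betw_def B'_def intro: inj_on_subset)
      have "f ` {b \<in> B'. a \<in> f b} = {e \<in> f ` B'. a \<in> e}" by blast
      also have "\<dots> = {e. e \<subseteq> A \<and> card e = Suc (r - 1) \<and> a \<in> e}"
        using bij r_pos by (simp add: bij_betw_def B'_def conj_assoc)
      finally show "f ` {b \<in> B'. a \<in> f b} = {e. e \<subseteq> A \<and> card e = Suc (r - 1) \<and> a \<in> e}" .
    qed
    then show ?thesis
      using card_subsets_containing[OF finA a] by (simp add: bij_betw_same_card d_def)
  qed
  have "{a \<in> A. a \<in> f b} = f b" if "b \<in> B'" for b
    using that nb_sub[of b] by (auto simp: B'_def)
  then have "(\<Sum>b\<in>B'. sum w (f b)) = (\<Sum>b\<in>B'. \<Sum>a\<in>{a \<in> A. a \<in> f b}. w a)"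
    by (intro sum.cong refl) simp
  also have "\<dots> = (\<Sum>a\<in>A. \<Sum>b\<in>{b \<in> B'. a \<in> f b}. w a)"
    using finA finB by (intro sum.swap_restrict) (auto simp: B'_def)
  also have "\<dots> = real d * sum w A"
    using deg by (simp add: sum_distrib_left)
  finally have swap: "(\<Sum>b\<in>B'. sum w (f b)) = real d * sum w A" .
  have "card B' = card A choose r"
    using bij_betw_same_card[OF bij] n_subsets[OF finA] by (simp add: B'_def)
  moreover have "r * (card A choose r) = card A * d"
    using times_binomial_minus1_eq[OF r_pos] by (simp add: d_def)
  ultimately have cardB: "real (card B') * real r = real d * real (card A)"
    by (simp only: of_nat_mult[symmetric] mult.commute)
  have d1: "1 \<le> d" using r_le r_pos by (simp add: d_def Suc_le_eq)
  have "real (card B') = (\<Sum>b\<in>B'. 1)" by simp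
  also have "\<dots> \<le> (\<Sum>b\<in>B'. w b + sum w (f b))"
    using constr by (intro sum_mono) (auto simp: B'_def)
  also have "\<dots> = sum w B' + real d * sum w A"
    by (simp add: sum.distrib swap)
  also have "\<dots> \<le> real d * sum w B' + real d * sum w A"
  proof -
    have "0 \<le> sum w B'" using nn by (intro sum_nonneg) (auto simp: B'_def)
    then show ?thesis using d1 mult_right_mono[of 1 "real d" "sum w B'"] by simp
  qed
  finally have "real (card B') \<le> real d * (sum w B' + sum w A)"
    by (simp add: algebra_simps)
  then have "real (card B') * real r \<le> real d * (sum w B' + sum w A) * real r"
    by (rule mult_right_mono) simp
  then have "real d * real (card A) \<le> real d * ((sum w B' + sum w A) * real r)"
    by (simp add: cardB mult.assoc)
  then have "real (card A) \<le> (sum w B' + sum w A) * real r"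
    using d1 by simp
  then have "real (card A) / real r \<le> sum w B' + sum w A"
    using r_pos by (simp add: divide_le_eq)
  moreover have "sum w B = w b0 + sum w B'"
    using sum.remove[OF finB b0, of w] by (simp add: B'_def)
  ultimately show ?thesis using one by (simp add: total_weight_split)
qed

text \<open>
  Consider a dominating position of the guards with one guard on \<open>b0\<close>. Replace each guard on
  another outer vertex by one of its neighbours. An outer vertex other than \<open>b0\<close> was
  dominated from itself or from its neighbourhood, so this neighbourhood now contains a guard.
  Hence the guards on \<open>A\<close> hit all \<open>r\<close>-subsets of \<open>A\<close>, and miss fewer than \<open>r\<close> elements of \<open>A\<close>.
\<close>

lemma m_eternal_dom_num_ge: "card A + 2 \<le> m_eternal_dom_num G + r"
proof -
  obtain D where D: "D \<subseteq> A \<union> B" "card D = m_eternal_dom_num G" "b0 \<in> D"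
    and dom: "A \<union> B \<subseteq> (\<Union>u\<in>D. closed_nbhd G u)"
    using m_eternally_dominatedD[OF pair_graph_G m_eternally_dominated_m_eternal_dom_num, of b0]
      b0 unfolding verts by blast
  define g where "g x = (if x \<in> A then x else SOME a. a \<in> f x)" for x
  have g: "g b \<in> f b" if "b \<in> B" for b
  proof -
    have "f b \<noteq> {}" using nb_card[OF that] r_pos by auto
    then show ?thesis using that disj by (auto simp: g_def some_in_eq)
  qed
  define H where "H = g ` (D - {b0})"
  have finD: "finite D" using D(1) finA finB by (meson finite_UnI finite_subset)
  have "card H \<le> card (D - {b0})" unfolding H_def using finD by (intro card_image_le) auto
  then have H: "card H + 1 \<le> card D"
    using D(3) finD by (metis Suc_eq_plus1 Suc_le_mono card_Suc_Diff1)
  have "card (A - H) < r"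
  proof (rule ccontr)
    assume "\<not> card (A - H) < r"
    then obtain e where e: "e \<subseteq> A - H" "card e = r"
      by (meson obtain_subset_with_card_n not_less)
    then have "e \<in> f ` (B - {b0})" using bij by (auto simp: bij_betw_def)
    then obtain b where b: "b \<in> B" "b \<noteq> b0" "f b = e" by auto
    then obtain u where u: "u \<in> D" "b \<in> closed_nbhd G u" using dom by blast
    have "g u \<in> f b"
    proof (cases "u = b")
      case False
      then have "u \<in> nbhd G b"
        using u nbhd_commute[OF pair_graph_G] by (auto simp: closed_nbhd_def)
      then show ?thesis using b nb_sub by (auto simp: nbhd_outer g_def)
    qed (use g b(1) in auto)
    moreover have "u \<noteq> b0"
    proof
      assume "u = b0"
      with u b have "b \<in> f b0" using b0 by (auto simp: closed_nbhd_def nbhd_outer)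
      with b b0 nb_sub disj show False by blast
    qed
    then have "g u \<in> H" using u by (auto simp: H_def)
    ultimately show False using b e by blast
  qed
  moreover have "card A \<le> card (A - H) + card H"
    using diff_card_le_card_Diff[of H A] finD by (simp add: H_def)
  ultimately show ?thesis using H D(2) by linarith
qed

definition position :: "'a \<Rightarrow> 'a \<Rightarrow> real" where
  "position s x = (if x \<in> A then 1 / real r else 0) + (if x = s then 1 else 0)"

text \<open>Where the extra unit of \<open>s\<close> lies when projected to \<open>A\<close>.\<close>

definition spread :: "'a \<Rightarrow> 'a \<Rightarrow> real" where
  "spread s x = (if s \<in> A then if x = s then 1 else 0 else if x \<in> f s then 1 / real r else 0)"

text \<open>The transport of \<open>excess_transport\<close>, from the distribution of \<open>s\<close> to that of \<open>t\<close>.\<close>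

definition shift :: "'a \<Rightarrow> 'a \<Rightarrow> 'a \<Rightarrow> 'a \<Rightarrow> real" where
  "shift s t x y = max 0 (spread s x - spread t x) * max 0 (spread t y - spread s y)
     / (\<Sum>a\<in>A. max 0 (spread s a - spread t a))"

definition carry :: "'a \<Rightarrow> 'a \<Rightarrow> 'a \<Rightarrow> 'a \<Rightarrow> real" where
  "carry s t x y =
     (if x \<in> A then if y \<in> A then shift s t x y else if y = t then 1 / real r else 0
      else if x = s then 1 / real r else 0)"

lemma sum_spread:
  assumes "s \<in> A \<union> B"
  shows "sum (spread s) A = 1"
proof (cases "s \<in> A")
  case True
  then show ?thesis using finA by (simp add: spread_def)
next
  case False
  then have s: "s \<in> B" using assms by blast
  have "sum (spread s) A = (\<Sum>x\<in>A. if x \<in> f s then 1 / real r else 0)"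
    using False by (simp add: spread_def)
  also have "\<dots> = (\<Sum>x\<in>f s. 1 / real r)"
    using nb_sub[OF s] by (simp add: sum.inter_restrict[OF finA, symmetric] Int_absorb1)
  also have "\<dots> = 1" using nb_card[OF s] r_pos by simp
  finally show ?thesis .
qed

lemma shift:
  assumes "s \<in> A \<union> B" "t \<in> A \<union> B"
  shows "0 \<le> shift s t x y"
    and "x \<in> A \<Longrightarrow> (\<Sum>y\<in>A - {x}. shift s t x y) = max 0 (spread s x - spread t x)"
    and "y \<in> A \<Longrightarrow> (\<Sum>x\<in>A - {y}. shift s t x y) = max 0 (spread t y - spread s y)"
proof -
  have eq: "sum (spread s) A = sum (spread t) A" using assms by (simp add: sum_spread)
  show "0 \<le> shift s t x y"
    unfolding shift_def by (rule excess_transport(1)[OF finA eq])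
  show "x \<in> A \<Longrightarrow> (\<Sum>y\<in>A - {x}. shift s t x y) = max 0 (spread s x - spread t x)"
    unfolding shift_def by (rule excess_transport(2)[OF finA eq])
  show "y \<in> A \<Longrightarrow> (\<Sum>x\<in>A - {y}. shift s t x y) = max 0 (spread t y - spread s y)"
    unfolding shift_def by (rule excess_transport(3)[OF finA eq])
qed

lemma sum_outer_nbhd:
  assumes "x \<in> A" "t \<in> A \<union> B"
  shows "(\<Sum>b\<in>{b \<in> B. x \<in> f b}. if b = t then 1 / real r else 0) = (if t \<in> A then 0 else spread t x)"
  using assms disj finB by (auto simp: sum.delta spread_def)

lemma sum_nbhd_clique:
  assumes "x \<in> A"
  shows "(\<Sum>y\<in>nbhd G x. h y) = (\<Sum>y\<in>A - {x}. h y) + (\<Sum>b\<in>{b \<in> B. x \<in> f b}. h b)"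
  unfolding nbhd_clique[OF assms] using finA finB disj
  by (intro sum.union_disjoint) auto

lemma carry_out_clique:
  assumes "s \<in> A \<union> B" "t \<in> A \<union> B" "x \<in> A"
  shows "(\<Sum>y\<in>nbhd G x. carry s t x y)
    = max 0 (spread s x - spread t x) + (if t \<in> A then 0 else spread t x)"
proof -
  have "(\<Sum>y\<in>A - {x}. carry s t x y) = (\<Sum>y\<in>A - {x}. shift s t x y)"
    using assms by (intro sum.cong) (auto simp: carry_def)
  moreover have "(\<Sum>b\<in>{b \<in> B. x \<in> f b}. carry s t x b)
      = (\<Sum>b\<in>{b \<in> B. x \<in> f b}. if b = t then 1 / real r else 0)"
    using assms disj by (intro sum.cong) (auto simp: carry_def)
  ultimately show ?thesis
    using assms by (simp add: sum_nbhd_clique shift sum_outer_nbhd)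
qed

lemma carry_in_clique:
  assumes "s \<in> A \<union> B" "t \<in> A \<union> B" "x \<in> A"
  shows "(\<Sum>y\<in>nbhd G x. carry s t y x)
    = max 0 (spread t x - spread s x) + (if s \<in> A then 0 else spread s x)"
proof -
  have "(\<Sum>y\<in>A - {x}. carry s t y x) = (\<Sum>y\<in>A - {x}. shift s t y x)"
    using assms by (intro sum.cong) (auto simp: carry_def)
  moreover have "(\<Sum>b\<in>{b \<in> B. x \<in> f b}. carry s t b x)
      = (\<Sum>b\<in>{b \<in> B. x \<in> f b}. if b = s then 1 / real r else 0)"
    using assms disj by (intro sum.cong) (auto simp: carry_def)
  ultimately show ?thesis
    using assms by (simp add: sum_nbhd_clique shift sum_outer_nbhd)
qed

lemma carry_out_outer:
  assumes "x \<in> B"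
  shows "(\<Sum>y\<in>nbhd G x. carry s t x y) = (if x = s then 1 else 0)"
proof -
  have "x \<notin> A" using assms disj by blast
  then show ?thesis using assms r_pos nb_card by (simp add: nbhd_outer carry_def)
qed

lemma carry_in_outer:
  assumes "x \<in> B"
  shows "(\<Sum>y\<in>nbhd G x. carry s t y x) = (if x = t then 1 else 0)"
proof -
  have "x \<notin> A" using assms disj by blast
  then have "(\<Sum>y\<in>nbhd G x. carry s t y x) = (\<Sum>y\<in>f x. if x = t then 1 / real r else 0)"
    using assms nb_sub[OF assms] by (intro sum.cong) (auto simp: nbhd_outer carry_def)
  then show ?thesis using assms r_pos nb_card by simp
qed

text \<open>
  A clique vertex sends out \<open>max (spread s x) (spread t x)\<close> if \<open>t\<close> is an outer vertex, and at most
  \<open>spread s x\<close> otherwise. This is at most \<open>1 / r\<close>, plus the extra unit if \<open>x = s\<close>.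
\<close>

lemma legal_move_carry:
  assumes "s \<in> A \<union> B" "t \<in> A \<union> B"
  shows "legal_move G (position s) (carry s t)"
  unfolding legal_move_def
proof (intro ballI conjI)
  fix x y show "0 \<le> carry s t x y"
    using shift(1)[OF assms] by (simp add: carry_def)
next
  fix x assume "x \<in> pverts G"
  then consider "x \<in> A" | "x \<in> B" "x \<notin> A" using disj by (auto simp: verts)
  then show "(\<Sum>y\<in>nbhd G x. carry s t x y) \<le> position s x"
  proof cases
    case 1
    have "max 0 (p - q) + (if t \<in> A then 0 else q) \<le> c"
      if "p \<le> c" "0 \<le> q" "t \<notin> A \<Longrightarrow> q \<le> c" "0 \<le> c" for p q c :: real
      using that by (cases "t \<in> A") (auto simp: max_def)
    moreover have "spread s x \<le> 1 / real r + (if x = s then 1 else 0)"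
      by (auto simp: spread_def)
    moreover have "0 \<le> spread t x"
      by (auto simp: spread_def)
    moreover have "spread t x \<le> 1 / real r + (if x = s then 1 else 0)" if "t \<notin> A"
      using that by (auto simp: spread_def)
    moreover have "0 \<le> 1 / real r + (if x = s then 1 else 0)" by simp
    ultimately have "max 0 (spread s x - spread t x) + (if t \<in> A then 0 else spread t x)
        \<le> 1 / real r + (if x = s then 1 else 0)"
      by blast
    then show ?thesis
      using assms 1 by (simp add: carry_out_clique position_def)
  next
    case 2
    then show ?thesis by (simp add: carry_out_outer position_def)
  qed
qed

lemma apply_move_carry:
  assumes "s \<in> A \<union> B" "t \<in> A \<union> B"
  shows "apply_move G (position s) (carry s t) = position t"
proof
  fix x
  consider "x \<in> A" | "x \<in> B" "x \<notin> A" | "x \<notin> A \<union> B" by blast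
  then show "apply_move G (position s) (carry s t) x = position t x"
  proof cases
    case 1
    have extra: "(if s \<in> A then spread s x else 0) = (if x = s then 1 else 0)" for s
      using 1 by (auto simp: spread_def)
    have "max 0 (spread t x - spread s x) - max 0 (spread s x - spread t x)
        = spread t x - spread s x"
      by linarith
    moreover have "spread u x - (if u \<in> A then 0 else spread u x) = (if x = u then 1 else 0)" for u
      using extra[of u] by (cases "u \<in> A") simp_all
    note this[of s] this[of t]
    ultimately show ?thesis
      unfolding apply_move_def carry_out_clique[OF assms 1] carry_in_clique[OF assms 1] position_def
      by linarith
  next
    case 2
    then show ?thesis
      by (simp add: apply_move_def carry_out_outer carry_in_outer position_def)
  next
    case 3
    then show ?thesis using assms
      by (auto simp: apply_move_def nbhd_outside position_def)
  qed
qed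

lemma eternally_frac_dominated_G: "eternally_frac_dominated G (1 + real (card A) / real r)"
proof (rule eternally_frac_dominatedI[where P = position and mv = carry and start = b0])
  have "sum (position b0) A = real (card A) / real r"
    using b0 disj finA by (auto simp: position_def sum.distrib)
  moreover have "sum (position b0) B = (\<Sum>x\<in>B. if x = b0 then 1 else 0)"
    using disj by (intro sum.cong) (auto simp: position_def)
  ultimately show "total_weight G (position b0) \<le> 1 + real (card A) / real r"
    using finB b0 by (simp add: total_weight_split)
  show "frac_dominating G (position s)" for s
    by (rule frac_dominating_if_ge) (auto simp: position_def)
qed (use b0 legal_move_carry apply_move_carry in \<open>auto simp: verts position_def\<close>)

lemma frac_eternal_dom_num_eq: "frac_eternal_dom_num G = 1 + real (card A) / real r"
  unfolding frac_eternal_dom_num_def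
proof (rule cInf_eq_minimum)
  fix S assume "S \<in> {S. eternally_frac_dominated G S}"
  then show "1 + real (card A) / real r \<le> S"
    using eternally_frac_dominatedD[OF pair_graph_G, of S b0] total_weight_ge b0
    by (fastforce simp: verts)
qed (use eternally_frac_dominated_G in simp)

end


section \<open>Realizing every rational number above two\<close>

theorem theorem3p4:
  fixes q :: real
  assumes "q \<in> \<rat>" and "q > 2"
  shows "\<exists>G :: nat pair_pre_digraph. pair_graph G \<and>
           frac_dom_num G < frac_eternal_dom_num G \<and>
           frac_eternal_dom_num G < real (m_eternal_dom_num G) \<and>
           frac_eternal_dom_num G = q"
proof -
  have "q - 1 \<in> \<rat>" using assms(1) by simp
  then obtain k l :: nat where l: "l \<noteq> 0" "\<bar>q - 1\<bar> = real k / real l"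
    by (rule Rats_abs_nat_div_natE)
  \<comment> \<open>Doubling the fraction ensures \<open>r \<ge> 2\<close>; for \<open>r = 1\<close> the integral and the fractional cost of
      hitting all \<open>r\<close>-subsets agree.\<close>
  define n r where "n = 2 * k" and "r = 2 * l"
  have q: "q = 1 + real n / real r" using l assms(2) by (simp add: n_def r_def)
  have r: "2 \<le> r" using l by (simp add: r_def)
  have "1 < real n / real r" using q assms(2) by linarith
  then have nr: "r < n" using r by (simp add: less_divide_eq)
  define \<E> where "\<E> = {e. e \<subseteq> {..<n} \<and> card e = r}"
  have "finite \<E>" by (rule finite_subset[of _ "Pow {..<n}"]) (auto simp: \<E>_def)
  then obtain h where h: "bij_betw h {0..<card \<E>} \<E>"
    using ex_bij_betw_nat_finite by blast
  define b0 where "b0 = n + card \<E>"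
  define f where "f v = (if v = b0 then {..<r} else h (v - n))" for v
  have "bij_betw (\<lambda>v. v - n) {n..<b0} {0..<card \<E>}"
    by (rule bij_betw_byWitness[where f' = "\<lambda>i. i + n"]) (auto simp: b0_def)
  from bij_betw_trans[OF this h] have "bij_betw f {n..<b0} \<E>"
    by (rule bij_betw_cong[THEN iffD1, rotated]) (auto simp: f_def)
  moreover have "{n..b0} - {b0} = {n..<b0}" by auto
  ultimately have bij: "bij_betw f ({n..b0} - {b0}) \<E>" by simp
  have f\<E>: "f b \<in> \<E>" if "b \<in> {n..b0}" for b
  proof (cases "b = b0")
    case True
    then show ?thesis using nr by (auto simp: f_def \<E>_def)
  next
    case False
    then show ?thesis using bij that by (auto simp: bij_betw_def)
  qed
  interpret clique_with_subsets "{..<n}" "{n..b0}" f r b0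
    by unfold_locales
      (use f\<E> bij r nr in \<open>auto simp: \<E>_def b0_def\<close>)
  have "real n / real r < real n - real r + 1"
  proof -
    have "0 < (real r - 1) * (real n - real r)" using r nr by simp
    then have "real n < (real n - real r + 1) * real r" by (simp add: algebra_simps)
    then show ?thesis using r by (simp add: divide_less_eq)
  qed
  moreover have "real n + 2 \<le> real (m_eternal_dom_num G) + real r"
    using m_eternal_dom_num_ge by simp
  ultimately have "q < real (m_eternal_dom_num G)" using q by simp
  then show ?thesis
    using pair_graph_G frac_dom_num_le frac_eternal_dom_num_eq q
    by (intro exI[of _ G]) auto
qed

end
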